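(* Let $n\ge1$ and let $\mathfrak{G}_n$ denote the class of strongly connected graphs $\Gamma$ with $n$ nodes, positive minimum out-degree and positive minimum in-degree. For every $\Gamma\in\mathfrak{G}_n$, $$m^\Gamma_\land> e\,\ln\bigl(n+1-\ln(n+1)\bigr).$$ Furthermore, $$\min_{\Gamma\in\mathfrak{G}_n} m^\Gamma_\land=e\ln n+O\!\left(\frac{1}{\ln n}\right)\quad (n\to\infty).$$
   Context: A graph $\Gamma$ is a finite simple directed graph: a finite node set $\mathcal{V}(\Gamma)$ and, for each node $v$, a set $\Gamma^+(v)\subseteq\mathcal{V}(\Gamma)$ of out-neighbours; loops are allowed, multiple arcs are not. $\Gamma$ is strongly connected if for any two distinct nodes $u,v$ there are directed paths from $u$ to $v$ and from $v$ to $u$. For $\mathbf{x}=(x_v)\in(0,\infty)^{\mathcal{V}(\Gamma)}$ the min-sum is $S^\Gamma_\land(\mathbf{x})=\sum_{v:\,\Gamma^+(v)\neq\emptyset} x_v/\min_{w\in\Gamma^+(v)}x_w$, and $m^\Gamma_\land=\inf_{\mathbf{x}}S^\Gamma_\land(\mathbf{x})$ (infimum over nonzero nonnegative vectors for which no term has the form $0/0$; terms $a/0$ with $a>0$ count as $+\infty$). Graphs are considered up to isomorphism. *)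

theory Defs
  imports
    Complex_Main
    "HOL-Library.Extended_Real"
    "HOL-Library.Landau_Symbols"
    "Graph_Theory.Digraph_Component"
    "Graph_Theory.Pair_Digraph"
begin

definition out_nbrs :: "'a pair_pre_digraph \<Rightarrow> 'a \<Rightarrow> 'a set" where
  "out_nbrs G v = {w. (v, w) \<in> parcs G}"

text \<open>
  Only the values of a vector on \<open>pverts G\<close> matter; elsewhere it is unconstrained. The
  last conjunct excludes terms of the form \<open>0 / 0\<close> from the min-sum.
\<close>

definition admissible :: "'a pair_pre_digraph \<Rightarrow> ('a \<Rightarrow> real) \<Rightarrow> bool" where
  "admissible G x \<longleftrightarrow>
     (\<forall>v\<in>pverts G. 0 \<le> x v) \<and> (\<exists>v\<in>pverts G. x v \<noteq> 0) \<and>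
     (\<forall>v\<in>pverts G. out_nbrs G v \<noteq> {} \<longrightarrow> \<not> (x v = 0 \<and> Min (x ` out_nbrs G v) = 0))"

text \<open>
  The division is that of \<^typ>\<open>ereal\<close>, where \<open>a / 0 = \<infinity>\<close> for \<open>a > 0\<close>.
\<close>

definition min_sum :: "'a pair_pre_digraph \<Rightarrow> ('a \<Rightarrow> real) \<Rightarrow> ereal" where
  "min_sum G x =
     (\<Sum>v | v \<in> pverts G \<and> out_nbrs G v \<noteq> {}. ereal (x v) / ereal (Min (x ` out_nbrs G v)))"

definition min_sum_inf :: "'a pair_pre_digraph \<Rightarrow> ereal" where
  "min_sum_inf G = (INF x \<in> {x. admissible G x}. min_sum G x)"

text \<open>
  In a \<^const>\<open>pair_fin_digraph\<close> the arcs are ordered pairs of nodes, so that loops are allowed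
  and multiple arcs are not.
\<close>

definition graph_class :: "nat \<Rightarrow> 'a pair_pre_digraph set" where
  "graph_class n = {G. pair_fin_digraph G \<and> card (pverts G) = n \<and>
     strongly_connected (with_proj G) \<and>
     0 < Min (out_degree (with_proj G) ` pverts G) \<and>
     0 < Min (in_degree (with_proj G) ` pverts G)}"

text \<open>
  The following says that \<open>m\<close> is the minimum of \<^const>\<open>min_sum_inf\<close> over
  the isomorphism classes of graphs in \<^term>\<open>graph_class n\<close>. Every finite
  graph is isomorphic to one whose nodes are natural numbers.
\<close>

definition is_class_min :: "nat \<Rightarrow> real \<Rightarrow> bool" where
  "is_class_min n m \<longleftrightarrow>
     (\<exists>G \<in> (graph_class n :: nat pair_pre_digraph set). min_sum_inf G = ereal m) \<and>
     (\<forall>G \<in> (graph_class n :: nat pair_pre_digraph set). ereal m \<le> min_sum_inf G)"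

end

theory Submission
  imports
    Defs
    "HOL-Analysis.Complex_Transcendental"
    "HOL-Real_Asymp.Real_Asymp"
begin

text \<open>
  The minimum over the class equals the minimum of \<open>p (n + 1 - p)\<^sup>1\<^sup>/\<^sup>p\<close> over \<open>1 \<le> p \<le> n\<close>. Let \<open>g v\<close> be the
  least value of \<open>x\<close> on the out-neighbours of \<open>v\<close>, and \<open>m\<close>, \<open>M\<close> the extreme values of \<open>x\<close>. By strong
  connectivity every threshold between \<open>m\<close> and \<open>M\<close> is crossed by an arc going down, so the ratios
  \<open>x v / g v\<close> exceeding 1 have product at least \<open>M / m\<close>; if there are \<open>p - 1\<close> of them, the
  \<open>n + 1 - p\<close> others are at least \<open>m / M\<close>, and the AM-GM inequality gives the lower bound. Equality
  holds for a directed \<open>p\<close>-cycle with one node blown up to \<open>n + 1 - p\<close> nodes. The asymptotics come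
  from \<open>p = \<lceil>ln n\<rceil>\<close>.
\<close>

section \<open>Elementary inequalities: \<open>p * q powr (1 / p)\<close> against
  \<open>e * ln (p + q - ln (p + q))\<close>\<close>

lemma less_lnI:
  fixes x y :: real
  assumes "exp x < y"
  shows "x < ln y"
  using assms ln_less_cancel_iff[of "exp x" y] exp_gt_zero[of x] by simp

text \<open>Taylor expansion up to order five; the remainder has even degree six and is nonnegative.
  The constant 11/30 is the value of the partial sum at \<open>z = 1\<close>, the largest one for
  which the excess over the quadratic stays nonnegative up to there.\<close>

lemma exp_minus_quadratic_lower:
  fixes z :: real
  assumes "z \<le> 1"
  shows "1 - z + 11 / 30 * z\<^sup>2 \<le> exp (- z)"
proof -
  obtain t where t: "exp (- z) = (\<Sum>m<6. (- z) ^ m / fact m) + exp t / fact 6 * (- z) ^ 6"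
    using Maclaurin_exp_le[of "- z" 6] by blast
  have "0 \<le> exp t / fact 6 * (- z) ^ 6" by simp
  then have "(\<Sum>m<6. (- z) ^ m / fact m) \<le> exp (- z)" using t by linarith
  moreover have "(\<Sum>m<6. (- z) ^ m / fact m)
      = 1 - z + 11 / 30 * z\<^sup>2 + z\<^sup>2 * ((1 - z) * ((z - 2)\<^sup>2 + 12) / 120)"
    by (simp add: eval_nat_numeral field_simps)
  moreover have "0 \<le> z\<^sup>2 * ((1 - z) * ((z - 2)\<^sup>2 + 12) / 120)"
    using assms by simp
  ultimately show ?thesis by linarith
qed

text \<open>The constant is 1 / (4 * 11/30), for which the quadratic in \<open>exp_gt_of_le\<close>
  has discriminant exactly zero; the strictness there comes from this bound.\<close>

lemma ln2_gt: "15 / 22 < ln (2 :: real)"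
proof -
  have "exp (15 :: real) = exp 1 ^ 15" by (simp flip: exp_of_nat_mult)
  also have "\<dots> < (272 / 100) ^ 15" using e_less_272 by (intro power_strict_mono) auto
  also have "\<dots> < 2 ^ 22" by (simp add: eval_nat_numeral)
  finally have "15 < ln ((2 :: real) ^ 22)" by (rule less_lnI)
  also have "\<dots> = 22 * ln (2 :: real)" by (subst ln_realpow) simp_all
  finally show ?thesis by simp
qed

lemma mult_ln2_le_ln_one_plus:
  fixes b :: real
  assumes "0 \<le> b" "b \<le> 1"
  shows "b * ln 2 \<le> ln (1 + b)"
proof -
  have "concave_on {0<..} (ln :: real \<Rightarrow> real)" by (rule ln_concave)
  then have "(1 - b) * ln 1 + b * ln 2 \<le> ln ((1 - b) *\<^sub>R 1 + b *\<^sub>R (2::real))"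
    using assms by (intro concave_onD) auto
  then show ?thesis by (simp add: algebra_simps)
qed

text \<open>
  For \<open>z = 1 - ln q / p\<close> one has \<open>T - ln q = p (exp (- z) - 1 + z)\<close>, so \<open>exp T - q \<ge> q (T - ln q)\<close>
  reduces the claim to the negativity of the discriminant of a quadratic in \<open>z\<close>.
\<close>

lemma exp_gt_of_le:
  fixes p q :: real
  assumes "1 \<le> p" "p \<le> q"
  defines "T \<equiv> p * exp (ln q / p - 1)"
  shows "p + q - ln (p + q) < exp T"
proof -
  define z where "z = 1 - ln q / p"
  define b where "b = p / q"
  have b: "0 < b" "b \<le> 1" and q: "0 < q" using assms by (auto simp: b_def)
  have z: "z \<le> 1" using assms by (simp add: z_def)
  have u: "ln q = p - p * z" using assms by (simp add: z_def field_simps)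
  have "T = p * exp (- z)" by (simp add: T_def z_def)
  then have "T - ln q \<ge> p * (11 / 30 * z\<^sup>2)"
    using exp_minus_quadratic_lower[OF z] assms(1) mult_left_mono[of "1 - z + 11 / 30 * z\<^sup>2" "exp (- z)" p]
    by (simp add: u algebra_simps)
  moreover have "q * (1 + (T - ln q)) \<le> q * exp (T - ln q)"
    using q by (intro mult_left_mono exp_ge_add_one_self) auto
  moreover have "q * exp (T - ln q) = exp T" using q by (simp add: exp_diff)
  ultimately have T: "q + p * q * (11 / 30 * z\<^sup>2) \<le> exp T"
    using q mult_left_mono[of "p * (11 / 30 * z\<^sup>2)" "T - ln q" q] by (simp add: algebra_simps)
  have "ln (p + q) = ln (q * (1 + b))" using q by (simp add: b_def distrib_left add.commute)
  also have "\<dots> = ln q + ln (1 + b)" using q b by (simp add: ln_mult)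
  finally have "p - ln (p + q) = p * z - ln (1 + b)" using u by simp
  moreover have "15 / 22 * b < ln (1 + b)"
    using mult_ln2_le_ln_one_plus[of b] b mult_strict_left_mono[OF ln2_gt b(1)] by linarith
  moreover have "p * z - 15 / 22 * b \<le> p * q * (11 / 30 * z\<^sup>2)"
  proof -
    have "0 \<le> 11 / 30 * (p * z - 15 / 11 * b)\<^sup>2" by simp
    also have "\<dots> = b * (p * q * (11 / 30 * z\<^sup>2) - p * z + 15 / 22 * b)"
      using q by (simp add: b_def field_simps power2_eq_square)
    finally show ?thesis using b by (simp add: zero_le_mult_iff)
  qed
  ultimately show ?thesis using T by linarith
qed

text \<open>The arguments are \<open>2 * q + 1\<close> for \<open>q\<close> from 2 to 6. Each
  exponent is split as \<open>k + s\<close>, with \<open>e < 2.72\<close> for the integer part and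
  \<open>1 + s + s\<^sup>2\<close> as upper bound of \<open>exp s\<close>.\<close>

lemma ln_lower_numerals:
  "153 / 100 < ln (5 :: real)" "18 / 10 < ln (7 :: real)"
  "206 / 100 < ln (9 :: real)" "233 / 100 < ln (11 :: real)" "25 / 10 < ln (13 :: real)"
proof -
  have *: "real k + s < ln a" if "0 \<le> s" "s \<le> 1" "(272 / 100) ^ k * (1 + s + s\<^sup>2) \<le> a" "0 < k" for k s and a :: real
  proof -
    have "exp (real k + s) = exp 1 ^ k * exp s" by (simp add: exp_add flip: exp_of_nat_mult)
    also have "\<dots> < (272 / 100) ^ k * exp s"
      using that e_less_272 by (intro mult_strict_right_mono power_strict_mono) auto
    also have "\<dots> \<le> (272 / 100) ^ k * (1 + s + s\<^sup>2)"
      using that by (intro mult_left_mono exp_bound) auto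
    finally have "exp (real k + s) < a" using that by linarith
    then show ?thesis by (rule less_lnI)
  qed
  show "153 / 100 < ln (5 :: real)" using *[of "53/100" 1 5] by (simp add: power2_eq_square)
  show "18 / 10 < ln (7 :: real)" using *[of "8/10" 1 7] by (simp add: power2_eq_square)
  show "206 / 100 < ln (9 :: real)" using *[of "6/100" 2 9] by (simp add: power2_eq_square)
  show "233 / 100 < ln (11 :: real)" using *[of "33/100" 2 11] by (simp add: power2_eq_square)
  show "25 / 10 < ln (13 :: real)" using *[of "5/10" 2 13] by (simp add: power2_eq_square)
qed

text \<open>The tangent at \<open>q = exp c\<close> to the convex function
  \<open>q * ln q\<close>.\<close>

lemma mult_ln_ge:
  fixes q c :: real
  assumes "0 < q"
  shows "(1 + c) * q - exp c \<le> q * ln q"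
proof -
  have "ln (exp c / q) \<le> exp c / q - 1" using assms by (intro ln_le_minus_one) auto
  then have "q * (c - ln q) \<le> q * (exp c / q - 1)"
    using assms by (intro mult_left_mono) (auto simp: ln_div)
  then show ?thesis using assms by (simp add: algebra_simps)
qed

text \<open>Two tangents to \<open>q * ln q\<close> suffice beyond \<open>q = 1\<close>: the one at
  \<open>exp 1\<close> up to 5 and the one at \<open>exp 2\<close> from 6 on.\<close>

lemma less_mult_ln_div_exp_plus_ln:
  fixes q :: nat
  assumes "1 \<le> q"
  shows "real q < real q * ln (real q) / exp 1 + ln (2 * real q + 1)"
proof -
  have e: "100 / 272 < 1 / exp (1 :: real)" using e_less_272 by (simp add: field_simps)
  have 1: "(1 + c) * q / exp 1 - exp c / exp 1 \<le> real q * ln q / exp 1" for c :: real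
    using divide_right_mono[OF mult_ln_ge[of "real q" c], of "exp 1"] assms
    by (simp add: diff_divide_distrib)
  consider "q = 1" | "q = 2" | "q = 3" | "q = 4" | "q = 5" | "6 \<le> q" using assms by linarith
  then show ?thesis
  proof cases
    case 1
    have "1 < ln (3 :: real)" using e_less_272 by (intro less_lnI) simp
    then show ?thesis using 1 by simp
  next
    \<comment> \<open>After division by \<open>exp 1\<close> this tangent has slope
      \<open>3 / exp 1 > 1\<close>, so with \<open>ln 13\<close> as a fixed bound the estimate at
      \<open>q = 6\<close> extends to all larger \<open>q\<close>.\<close>
    case 6
    have "exp 2 / exp 1 = exp (1 :: real)" by (simp flip: exp_diff)
    then have "3 * q / exp 1 - exp 1 \<le> real q * ln q / exp 1" using 1[of 2] by simp
    moreover have "3 * q * (100 / 272) \<le> 3 * q / exp 1"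
      using e mult_left_mono[of "100 / 272" "1 / exp 1" "3 * real q"] by simp
    moreover have "ln 13 \<le> ln (2 * real q + 1)" using 6 by simp
    ultimately show ?thesis using ln_lower_numerals(5) e_less_272 6 by linarith
  qed (use 1[of 1] e ln_lower_numerals in simp_all)
qed

text \<open>By \<open>1 + y \<le> exp y\<close>, \<open>T\<close> is at least
  \<open>(p + ln q) / e\<close>. Since \<open>p \<le> exp (p / e)\<close>, \<open>exp T\<close> is
  at least \<open>p * (1 + ln q / e)\<close>, hence at least \<open>p + q * ln q / e\<close>. As
  \<open>2 * q + 1 \<le> p + q\<close>, the preceding lemma finishes.\<close>

lemma exp_gt_of_less:
  fixes p q :: nat
  assumes "1 \<le> q" "q < p"
  defines "T \<equiv> p * exp (ln q / p - 1)"
  shows "p + q - ln (p + q) < exp T"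
proof -
  let ?u = "ln (real q)"
  have u: "0 \<le> ?u" using assms by simp
  have "p * (1 + ?u / p) / exp 1 \<le> p * exp (?u / p) / exp 1"
    by (intro divide_right_mono mult_left_mono exp_ge_add_one_self) auto
  then have "p / exp 1 + ?u / exp 1 \<le> T"
    using assms by (simp add: T_def exp_diff distrib_left add_divide_distrib)
  then have "exp (p / exp 1) * exp (?u / exp 1) \<le> exp T" by (simp flip: exp_add)
  moreover have "real p \<le> exp (p / exp 1)"
  proof -
    have "exp 1 * (p / exp 1) \<le> exp 1 * exp (p / exp 1 - 1)"
      using exp_ge_add_one_self[of "p / exp 1 - 1"] by (intro mult_left_mono) auto
    then show ?thesis by (simp flip: exp_add)
  qed
  then have "p * (1 + ?u / exp 1) \<le> exp (p / exp 1) * exp (?u / exp 1)"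
    using u by (intro mult_mono exp_ge_add_one_self) auto
  moreover have "real q * ?u / exp 1 \<le> real p * ?u / exp 1"
    using assms u by (intro divide_right_mono mult_right_mono) auto
  moreover have "ln (2 * real q + 1) \<le> ln (p + q)" using assms by simp
  ultimately show ?thesis
    using less_mult_ln_div_exp_plus_ln[OF assms(1)] by (simp add: algebra_simps)
qed

text \<open>\<open>T\<close> is the right-hand side divided by \<open>e\<close>; the comparison is
  made after exponentiation, where \<open>p \<le> q\<close> and \<open>q < p\<close> have separate
  estimates.\<close>

lemma mult_powr_inverse_gt:
  fixes p q :: nat
  assumes "1 \<le> p" "1 \<le> q"
  shows "exp 1 * ln (p + q - ln (p + q)) < p * q powr (1 / p)"
proof -
  define T where "T = p * exp (ln q / p - 1)"
  have "p + q - ln (p + q) < exp T"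
    using exp_gt_of_le[of p q] exp_gt_of_less[of q p] assms unfolding T_def
    by (cases "p \<le> q") auto
  moreover have "0 < p + q - ln (p + q)"
    using ln_less_self[of "real (p + q)"] assms by simp
  ultimately have "ln (p + q - ln (p + q)) < T"
    by (metis ln_exp ln_less_cancel_iff exp_gt_zero)
  then have "exp 1 * ln (p + q - ln (p + q)) < exp 1 * T" by simp
  also have "\<dots> = p * q powr (1 / p)"
    using assms by (simp add: T_def exp_diff powr_def)
  finally show ?thesis .
qed

section \<open>The lower bound for a sum of ratios\<close>

text \<open>An interval containing the left end \<open>l\<close> is removed. Being half-open, it has
  no point from its right end on, so the others cover what remains.\<close>

lemma cover_length_le:
  fixes a b :: "'i \<Rightarrow> real"
  assumes "finite K" "\<And>i. i \<in> K \<Longrightarrow> a i \<le> b i" "{l..<h} \<subseteq> (\<Union>i\<in>K. {a i..<b i})"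
  shows "h - l \<le> (\<Sum>i\<in>K. b i - a i)"
  using assms
proof (induction K arbitrary: l rule: finite_psubset_induct)
  case (psubset K)
  show ?case
  proof (cases "l < h")
    case False
    moreover have "0 \<le> (\<Sum>i\<in>K. b i - a i)" using psubset.prems(1) by (intro sum_nonneg) auto
    ultimately show ?thesis by linarith
  next
    case True
    then obtain i where i: "i \<in> K" "a i \<le> l" "l < b i" using psubset.prems(2) by fastforce
    have "{b i..<h} \<subseteq> (\<Union>j\<in>K - {i}. {a j..<b j})"
    proof
      fix t assume t: "t \<in> {b i..<h}"
      then have "t \<in> {l..<h}" using i by auto
      then obtain j where "j \<in> K" "t \<in> {a j..<b j}" using psubset.prems(2) by auto
      moreover from this have "j \<noteq> i" using t by auto
      ultimately show "t \<in> (\<Union>j\<in>K - {i}. {a j..<b j})" by auto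
    qed
    then have "h - b i \<le> (\<Sum>j\<in>K - {i}. b j - a j)"
      using i psubset.prems(1) by (intro psubset.IH) auto
    then show ?thesis using i psubset.hyps by (subst sum.remove[of _ i]) auto
  qed
qed

lemma tangent_ln_le:
  fixes r c :: real
  assumes "0 < r" "0 < c"
  shows "c * (1 + ln r - ln c) \<le> r"
proof -
  have "c * ln (r / c) \<le> c * (r / c - 1)"
    using assms by (intro mult_left_mono ln_le_minus_one) auto
  then show ?thesis using assms by (simp add: ln_div algebra_simps)
qed

text \<open>
  AM-GM is applied in the form of the tangent inequality at the value \<open>c\<close> that all terms share
  in the case of equality.
\<close>

lemma sum_ratio_ge:
  fixes x g :: "'a \<Rightarrow> real"
  assumes V: "finite V" "V \<noteq> {}" and pos: "\<And>v. v \<in> V \<Longrightarrow> 0 < x v"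
    and g: "\<And>v. v \<in> V \<Longrightarrow> g v \<in> x ` V"
    and cut: "\<And>t. \<exists>v\<in>V. x v \<le> t \<Longrightarrow> \<exists>v\<in>V. t < x v \<Longrightarrow> \<exists>v\<in>V. g v \<le> t \<and> t < x v"
  shows "\<exists>p\<in>{1..card V}. real p * real (card V + 1 - p) powr (1 / real p) \<le> (\<Sum>v\<in>V. x v / g v)"
proof -
  define m where "m = Min (x ` V)"
  define M where "M = Max (x ` V)"
  define K where "K = {v\<in>V. g v < x v}"
  define k where "k = card K"
  define p where "p = Suc k"
  define q where "q = card V - k"
  define c where "c = real q powr (1 / real p)"
  have m_in: "m \<in> x ` V" and M_in: "M \<in> x ` V" using V by (auto simp: m_def M_def)
  have bounds: "m \<le> x v" "x v \<le> M" if "v \<in> V" for v using that V by (auto simp: m_def M_def)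
  have m: "0 < m" and M: "0 < M" using m_in M_in pos by auto
  have g_bounds: "m \<le> g v" "g v \<le> M" if "v \<in> V" for v using g[OF that] bounds by auto
  have gpos: "0 < g v" if "v \<in> V" for v using g_bounds[OF that] m by linarith
  obtain v0 where v0: "v0 \<in> V" "x v0 = m" using m_in by auto
  have K: "finite K" "K \<subseteq> V" using V by (auto simp: K_def)
  \<comment> \<open>At a node of least value the ratio is at most 1; this makes \<open>q\<close>
    positive.\<close>
  have "v0 \<notin> K" using v0 g_bounds[of v0] by (auto simp: K_def)
  then have kn: "k < card V"
    unfolding k_def using K V v0 by (intro psubset_card_mono) auto
  then have q: "0 < q" and p: "p \<in> {1..card V}" and qp: "card V + 1 - p = q"
    by (auto simp: q_def p_def)
  have c: "0 < c" and lnc: "real p * ln c = ln q" using q by (auto simp: c_def p_def ln_powr)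
  define L where "L = ln M - ln m"
  \<comment> \<open>The intervals of \<open>K\<close> on the logarithmic scale cover the whole range
    of \<open>x\<close>, so the logarithms of the ratios in \<open>K\<close> sum to at least
    \<open>L\<close>.\<close>
  have cover: "{ln m..<ln M} \<subseteq> (\<Union>v\<in>K. {ln (g v)..<ln (x v)})"
  proof
    fix t assume t: "t \<in> {ln m..<ln M}"
    then have "m \<le> exp t" "exp t < M" using m M exp_le_cancel_iff[of "ln m" t] exp_less_cancel_iff[of t "ln M"] by simp_all
    then obtain v where v: "v \<in> V" "g v \<le> exp t" "exp t < x v"
      using cut[of "exp t"] m_in M_in by auto
    have "ln (g v) \<le> t" using v gpos[of v] by (metis ln_exp ln_le_cancel_iff exp_gt_zero)
    moreover have "t < ln (x v)" using v by (intro less_lnI)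
    ultimately show "t \<in> (\<Union>v\<in>K. {ln (g v)..<ln (x v)})" using v by (auto simp: K_def)
  qed
  have "L \<le> (\<Sum>v\<in>K. ln (x v) - ln (g v))"
    unfolding L_def
  proof (rule cover_length_le[OF K(1) _ cover])
    fix v assume "v \<in> K"
    then show "ln (g v) \<le> ln (x v)" using gpos[of v] by (simp add: K_def)
  qed
  then have "c * (k * (1 - ln c) + L) \<le> c * (k * (1 - ln c) + (\<Sum>v\<in>K. ln (x v) - ln (g v)))"
    using c by simp
  also have "\<dots> = (\<Sum>v\<in>K. c * (1 + ln (x v / g v) - ln c))"
  proof -
    have "(\<Sum>v\<in>K. c * (1 + ln (x v / g v) - ln c)) = (\<Sum>v\<in>K. c * ((1 - ln c) + (ln (x v) - ln (g v))))"
      using K pos gpos by (intro sum.cong refl) (auto simp: ln_div subset_iff less_imp_neq[symmetric])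
    also have "\<dots> = c * (k * (1 - ln c) + (\<Sum>v\<in>K. ln (x v) - ln (g v)))"
      by (simp add: sum.distrib k_def flip: sum_distrib_left)
    finally show ?thesis by (rule sym)
  qed
  also have "\<dots> \<le> (\<Sum>v\<in>K. x v / g v)"
    using K pos gpos c by (intro sum_mono tangent_ln_le) auto
  finally have 1: "c * (k * (1 - ln c) + L) \<le> (\<Sum>v\<in>K. x v / g v)" .
  \<comment> \<open>The tangent inequality is applied once, to \<open>q * (m / M)\<close>, which
    bounds the total over \<open>V - K\<close> from below. That total counts as a single term, hence
    \<open>p = k + 1\<close>.\<close>
  have "c * (1 + ln (q * (m / M)) - ln c) \<le> q * (m / M)"
    using c q m M by (intro tangent_ln_le) auto
  also have "ln (q * (m / M)) = ln q - L"
    using q m M by (simp add: ln_mult ln_div L_def)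
  also have "q * (m / M) = (\<Sum>v\<in>V - K. m / M)"
    using K V by (simp add: q_def k_def card_Diff_subset)
  also have "\<dots> \<le> (\<Sum>v\<in>V - K. x v / g v)"
    using m gpos bounds g_bounds by (intro sum_mono frac_le) (auto intro: less_imp_le[OF pos])
  finally have 2: "c * (1 + (ln q - L) - ln c) \<le> (\<Sum>v\<in>V - K. x v / g v)" .
  \<comment> \<open>The spread \<open>L\<close> cancels, and \<open>p * ln c = ln q\<close> leaves
    \<open>p * c\<close>.\<close>
  have "c * (k * (1 - ln c) + L) + c * (1 + (ln q - L) - ln c) = c * (p + ln q - p * ln c)"
    by (simp add: p_def algebra_simps)
  then have "p * c = c * (k * (1 - ln c) + L) + c * (1 + (ln q - L) - ln c)"
    using lnc by simp
  also have "\<dots> \<le> (\<Sum>v\<in>V - K. x v / g v) + (\<Sum>v\<in>K. x v / g v)" using 1 2 by linarith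
  also have "\<dots> = (\<Sum>v\<in>V. x v / g v)" by (rule sum.subset_diff[OF K(2) V(1), symmetric])
  finally show ?thesis using p qp by (auto simp: c_def)
qed

section \<open>Strong connectivity and positive out-degree\<close>

text \<open>A directed path from \<open>u\<close> to \<open>v\<close> must leave \<open>P\<close>
  along some arc.\<close>

lemma graph_class_cut:
  assumes G: "G \<in> graph_class n"
    and "u \<in> pverts G" "P u" "v \<in> pverts G" "\<not> P v"
  obtains a b where "(a, b) \<in> parcs G" "P a" "\<not> P b"
proof -
  interpret pair_fin_digraph G using G by (simp add: graph_class_def)
  have "u \<rightarrow>\<^sup>*\<^bsub>with_proj G\<^esub> v"
    using G assms by (auto simp: graph_class_def strongly_connected_def)
  then have "P v \<or> (\<exists>(a, b)\<in>parcs G. P a \<and> \<not> P b)"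
    by (induction rule: reachable_induct) (use assms in auto)
  then show ?thesis using assms that by auto
qed

text \<open>Makes the filter in \<open>min_sum\<close> vacuous and each \<open>Min\<close> there one
  over a nonempty finite set.\<close>

lemma graph_class_out_nbrs:
  assumes "G \<in> graph_class n" "v \<in> pverts G"
  shows "out_nbrs G v \<noteq> {}" "finite (out_nbrs G v)" "out_nbrs G v \<subseteq> pverts G"
proof -
  interpret pair_fin_digraph G using assms by (simp add: graph_class_def)
  have "0 < out_degree (with_proj G) v"
    using assms pair_finite_verts Min_gr_iff[of "out_degree (with_proj G) ` pverts G" 0]
    by (auto simp: graph_class_def)
  then have "out_arcs (with_proj G) v \<noteq> {}" unfolding out_degree_def by force
  then show "out_nbrs G v \<noteq> {}" by (auto simp: out_nbrs_def out_arcs_def)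
  show sub: "out_nbrs G v \<subseteq> pverts G" by (auto simp: out_nbrs_def dest: wellformed')
  show "finite (out_nbrs G v)" using sub pair_finite_verts finite_subset by blast
qed

section \<open>The explicit minimum as a lower bound for the whole class\<close>

definition min_value :: "nat \<Rightarrow> real" where
  "min_value n = Min ((\<lambda>p. real p * real (n + 1 - p) powr (1 / real p)) ` {1..n})"

lemma min_value_le:
  assumes "p \<in> {1..n}"
  shows "min_value n \<le> real p * real (n + 1 - p) powr (1 / real p)"
  using assms by (simp add: min_value_def)

lemma min_value_attained:
  assumes "1 \<le> n"
  obtains p where "p \<in> {1..n}" "min_value n = real p * real (n + 1 - p) powr (1 / real p)"
proof -
  have "min_value n \<in> (\<lambda>p. real p * real (n + 1 - p) powr (1 / real p)) ` {1..n}"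
    unfolding min_value_def using assms by (intro Min_in) auto
  then show ?thesis using that by auto
qed

text \<open>For positive \<open>x\<close> this is \<open>sum_ratio_ge\<close>, with crossings
  supplied by \<open>graph_class_cut\<close>. If \<open>x\<close> vanishes somewhere, an arc from a
  positive to a zero entry yields an infinite term.\<close>

lemma min_value_le_min_sum:
  assumes G: "G \<in> graph_class n" and x: "admissible G x"
  shows "ereal (min_value n) \<le> min_sum G x"
proof -
  interpret pair_fin_digraph G using G by (simp add: graph_class_def)
  let ?V = "pverts G" and ?g = "\<lambda>v. Min (x ` out_nbrs G v)"
  note out = graph_class_out_nbrs[OF G]
  have nn: "0 \<le> x v" if "v \<in> ?V" for v using x that by (simp add: admissible_def)
  have sum: "min_sum G x = (\<Sum>v\<in>?V. ereal (x v) / ereal (?g v))"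
    unfolding min_sum_def using out(1) by (intro sum.cong) auto
  have g_le: "?g a \<le> x b" if "(a, b) \<in> parcs G" for a b
    using out(2)[of a] that wellformed' by (intro Min_le) (auto simp: out_nbrs_def)
  have g_in: "?g v \<in> x ` ?V" if "v \<in> ?V" for v
    using out[OF that] Min_in[of "x ` out_nbrs G v"] by blast
  show ?thesis
  proof (cases "\<forall>v\<in>?V. 0 < x v")
    case True
    have "\<exists>v\<in>?V. ?g v \<le> t \<and> t < x v" if "\<exists>v\<in>?V. x v \<le> t" "\<exists>v\<in>?V. t < x v" for t
    proof -
      from that obtain u w where "u \<in> ?V" "t < x u" "w \<in> ?V" "\<not> t < x w" by force
      then obtain a b where "(a, b) \<in> parcs G" "t < x a" "\<not> t < x b"
        by (rule graph_class_cut[OF G, of u "\<lambda>v. t < x v" w])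
      then show ?thesis using g_le[of a b] wellformed' by force
    qed
    moreover have "?V \<noteq> {}" using G by (auto simp: graph_class_def strongly_connected_def)
    ultimately obtain p where "p \<in> {1..card ?V}"
      "real p * real (card ?V + 1 - p) powr (1 / real p) \<le> (\<Sum>v\<in>?V. x v / ?g v)"
      using sum_ratio_ge[of ?V x ?g] True g_in pair_finite_verts by blast
    moreover have "card ?V = n" using G by (simp add: graph_class_def)
    ultimately have "min_value n \<le> (\<Sum>v\<in>?V. x v / ?g v)" using min_value_le[of p n] by simp
    moreover have "min_sum G x = (\<Sum>v\<in>?V. ereal (x v / ?g v))"
      unfolding sum
    proof (intro sum.cong refl)
      fix v assume "v \<in> ?V"
      then have "0 < ?g v" using g_in[of v] True by auto
      then show "ereal (x v) / ereal (?g v) = ereal (x v / ?g v)" by simp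
    qed
    ultimately show ?thesis by simp
  next
    case False
    then obtain w where w: "w \<in> ?V" "\<not> 0 < x w" by auto
    obtain u where "u \<in> ?V" "0 < x u" using x by (force simp: admissible_def)
    then obtain a b where ab: "(a, b) \<in> parcs G" "0 < x a" "\<not> 0 < x b"
      by (rule graph_class_cut[OF G, of u "\<lambda>v. 0 < x v" w]) (use w in auto)
    then have "?g a \<le> 0" using g_le[of a b] by linarith
    moreover have aV: "a \<in> ?V" using ab wellformed' by auto
    then have "0 \<le> ?g a" using g_in[of a] nn by auto
    ultimately have "ereal (x a) / ereal (?g a) = \<infinity>" using ab by simp
    then have "min_sum G x = \<infinity>" unfolding sum using aV pair_finite_verts sum_Pinfty by blast
    then show ?thesis by simp
  qed
qed

lemma min_value_le_min_sum_inf: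
  assumes "G \<in> graph_class n"
  shows "ereal (min_value n) \<le> min_sum_inf G"
  unfolding min_sum_inf_def using min_value_le_min_sum[OF assms] by (intro INF_greatest) auto

section \<open>Blown-up cycles attain the bound\<close>

text \<open>
  The directed cycle on the levels \<open>0, \<dots>, k\<close>, with level \<open>k\<close> blown up to \<open>n - k\<close> nodes; the level
  of node \<open>i\<close> is \<open>min i k\<close>.
\<close>

definition cycle_blowup :: "nat \<Rightarrow> nat \<Rightarrow> nat pair_pre_digraph" where
  "cycle_blowup n k = \<lparr>pverts = {..<n},
     parcs = {(i, j). i < n \<and> j < n \<and> min j k = Suc (min i k) mod Suc k}\<rparr>"

lemma cycle_blowup_simps [simp]:
  "pverts (cycle_blowup n k) = {..<n}"
  "(i, j) \<in> parcs (cycle_blowup n k) \<longleftrightarrow> i < n \<and> j < n \<and> min j k = Suc (min i k) mod Suc k"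
  by (auto simp: cycle_blowup_def)

lemma out_nbrs_cycle_blowup:
  assumes "i < n"
  shows "out_nbrs (cycle_blowup n k) i = {j. j < n \<and> min j k = Suc (min i k) mod Suc k}"
  using assms by (auto simp: out_nbrs_def)

text \<open>The least node of level \<open>l\<close> is \<open>l\<close> itself, so the number of
  the next level is also a node on it.\<close>

lemma cycle_blowup_succ:
  assumes "k < n" "i < n"
  shows "(i, Suc (min i k) mod Suc k) \<in> parcs (cycle_blowup n k)"
proof -
  have "Suc (min i k) mod Suc k < Suc k" by simp
  then show ?thesis using assms by (simp del: mod_less_divisor)
qed

lemma cycle_blowup_pred:
  assumes "k < n" "j < n"
  shows "\<exists>i. (i, j) \<in> parcs (cycle_blowup n k)"
proof (cases "min j k")
  case 0
  then show ?thesis using assms by (intro exI[of _ k]) auto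
next
  case (Suc l)
  then show ?thesis using assms by (intro exI[of _ l]) auto
qed

lemma pair_fin_digraph_cycle_blowup: "pair_fin_digraph (cycle_blowup n k)"
proof
  have "parcs (cycle_blowup n k) \<subseteq> {..<n} \<times> {..<n}" by auto
  then show "finite (parcs (cycle_blowup n k))" by (rule finite_subset) auto
qed auto

text \<open>All paths are routed through node 0. A node beyond \<open>k\<close> is entered from
  level \<open>k - 1\<close>.\<close>

lemma strongly_connected_cycle_blowup:
  assumes "k < n"
  shows "strongly_connected (with_proj (cycle_blowup n k))"
proof -
  let ?G = "cycle_blowup n k"
  interpret pair_fin_digraph ?G by (rule pair_fin_digraph_cycle_blowup)
  have arc: "i \<rightarrow>\<^sup>*\<^bsub>with_proj ?G\<^esub> j" if "i < n" "j < n" "min j k = Suc (min i k) mod Suc k" for i j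
    using that by (intro reachable_adjI) auto
  have to0: "u \<rightarrow>\<^sup>*\<^bsub>with_proj ?G\<^esub> 0" if "u < n" for u
  proof (cases "k \<le> u")
    case True
    then show ?thesis using that by (intro arc) auto
  next
    case False
    then have "u \<le> k" by simp
    then show ?thesis
    proof (induction rule: inc_induct)
      case base
      then show ?case using assms by (intro arc) auto
    next
      case (step i)
      then have "i \<rightarrow>\<^sup>*\<^bsub>with_proj ?G\<^esub> Suc i" using assms by (intro arc) auto
      then show ?case using step.IH by (rule reachable_trans)
    qed
  qed
  have from0: "0 \<rightarrow>\<^sup>*\<^bsub>with_proj ?G\<^esub> v" if "v \<le> k" for v
    using that
  proof (induction v)
    case 0
    then show ?case using assms by auto
  next
    case (Suc v)
    then show ?case using assms by (intro reachable_trans[OF Suc.IH arc]) auto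
  qed
  have from0': "0 \<rightarrow>\<^sup>*\<^bsub>with_proj ?G\<^esub> v" if "v < n" for v
  proof (cases "v \<le> k")
    case False
    show ?thesis
    \<comment> \<open>For \<open>k = 0\<close> there is no preceding level: all nodes form one level
      and every arc is present.\<close>
    proof (cases k)
      case 0
      then show ?thesis using that by (intro arc) auto
    next
      case (Suc l)
      then show ?thesis using False that by (intro reachable_trans[OF from0[of l] arc]) auto
    qed
  qed (rule from0)
  show ?thesis
    using assms to0 from0' by (intro strongly_connectedI) (auto intro: reachable_trans)
qed

lemma cycle_blowup_in_graph_class:
  assumes "k < n"
  shows "cycle_blowup n k \<in> graph_class n"
proof -
  let ?G = "cycle_blowup n k"
  interpret pair_fin_digraph ?G by (rule pair_fin_digraph_cycle_blowup)
  have "0 < out_degree (with_proj ?G) i" if "i < n" for i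
  proof -
    have "out_arcs (with_proj ?G) i \<noteq> {}"
      using cycle_blowup_succ[OF assms that] unfolding out_arcs_def by fastforce
    then show ?thesis by (simp add: out_degree_def card_gt_0_iff finite_out_arcs)
  qed
  moreover have "0 < in_degree (with_proj ?G) j" if "j < n" for j
  proof -
    have "in_arcs (with_proj ?G) j \<noteq> {}"
      using cycle_blowup_pred[OF assms that] unfolding in_arcs_def by fastforce
    then show ?thesis by (simp add: in_degree_def card_gt_0_iff finite_in_arcs)
  qed
  ultimately show ?thesis
    using assms strongly_connected_cycle_blowup[OF assms] pair_fin_digraph_cycle_blowup[of n k]
    by (auto simp: graph_class_def lessThan_empty_iff)
qed

lemma min_sum_inf_cycle_blowup_le:
  assumes "k < n"
  shows "min_sum_inf (cycle_blowup n k) \<le> ereal (real (Suc k) * real (n - k) powr (1 / real (Suc k)))"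
proof -
  let ?G = "cycle_blowup n k"
  define c where "c = real (n - k) powr (1 / real (Suc k))"
  have c: "0 < c" using assms by (simp add: c_def)
  \<comment> \<open>\<open>c\<close> is the root that makes the blown-up level contribute
    \<open>c\<close> in total, as each earlier level does.\<close>
  have cp: "c * c ^ k = real (n - k)"
    using assms c powr_realpow[OF c, of "Suc k"] by (simp add: c_def powr_powr del: of_nat_Suc)
  \<comment> \<open>Values fall by the factor \<open>c\<close> from level to level, and the step
    from level \<open>k\<close> back to level 0 has ratio \<open>1 / c ^ k\<close>.\<close>
  define x where "x i = 1 / c ^ min i k" for i :: nat
  have succ: "Suc (min i k) mod Suc k \<in> out_nbrs ?G i" if "i < n" for i
    unfolding out_nbrs_def using cycle_blowup_succ[OF assms that] by blast
  have g: "Min (x ` out_nbrs ?G i) = 1 / c ^ (Suc (min i k) mod Suc k)" if "i < n" for i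
  proof -
    \<comment> \<open>All out-neighbours of a node share one level, on which \<open>x\<close> is
      constant.\<close>
    have "x ` out_nbrs ?G i = {1 / c ^ (Suc (min i k) mod Suc k)}"
      using that succ[OF that] by (auto simp: out_nbrs_cycle_blowup x_def image_iff)
    then show ?thesis by simp
  qed
  have xpos: "0 < x i" for i using c by (simp add: x_def)
  then have "admissible ?G x"
    using assms by (auto simp: admissible_def less_imp_le less_imp_neq[symmetric])
  then have "min_sum_inf ?G \<le> min_sum ?G x"
    unfolding min_sum_inf_def by (intro INF_lower) auto
  also have "min_sum ?G x = (\<Sum>i<n. ereal (if i < k then c else 1 / c ^ k))"
    unfolding min_sum_def
  proof (intro sum.cong)
    show "{v \<in> pverts ?G. out_nbrs ?G v \<noteq> {}} = {..<n}"
      using succ by auto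
    fix i assume "i \<in> {..<n}"
    then have i: "i < n" by simp
    show "ereal (x i) / ereal (Min (x ` out_nbrs ?G i)) = ereal (if i < k then c else 1 / c ^ k)"
      unfolding g[OF i] using c by (auto simp: x_def)
  qed
  also have "\<dots> = ereal (\<Sum>i<n. if i < k then c else 1 / c ^ k)" by simp
  also have "(\<Sum>i<n. if i < k then c else 1 / c ^ k) = k * c + real (n - k) / c ^ k"
  proof -
    have "{..<n} \<inter> {i. i < k} = {..<k}" "{..<n} \<inter> - {i. i < k} = {k..<n}" using assms by auto
    then show ?thesis by (simp add: sum.If_cases)
  qed
  also have "real (n - k) / c ^ k = c" using c by (simp add: divide_eq_eq cp)
  finally show ?thesis by (simp add: c_def algebra_simps)
qed

section \<open>The class minimum and its asymptotics\<close>

lemma is_class_min_min_value: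
  assumes "1 \<le> n"
  shows "is_class_min n (min_value n)"
proof -
  obtain p where p: "p \<in> {1..n}" "min_value n = real p * real (n + 1 - p) powr (1 / real p)"
    using min_value_attained[OF assms] .
  then obtain k where k: "p = Suc k" "k < n" by (cases p) auto
  then have "min_sum_inf (cycle_blowup n k) \<le> ereal (min_value n)"
    using min_sum_inf_cycle_blowup_le[of k n] p by simp
  then show ?thesis
    unfolding is_class_min_def
    using min_value_le_min_sum_inf cycle_blowup_in_graph_class[OF k(2)] by (metis order_antisym)
qed

lemma min_value_gt:
  assumes "1 \<le> n"
  shows "exp 1 * ln (real n + 1 - ln (real n + 1)) < min_value n"
proof -
  obtain p where p: "p \<in> {1..n}" "min_value n = real p * real (n + 1 - p) powr (1 / real p)"
    using min_value_attained[OF assms] .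
  define q where "q = n + 1 - p"
  have "1 \<le> p" "1 \<le> q" "p + q = n + 1" using p by (auto simp: q_def)
  then show ?thesis using mult_powr_inverse_gt[of p q] p(2) by (simp add: q_def add.commute)
qed

text \<open>Over real \<open>p\<close>, \<open>p * n powr (1 / p)\<close> is least at
  \<open>p = ln n\<close>, with value \<open>e * ln n\<close>. Rounding \<open>p\<close> up costs a
  factor controlled by \<open>s\<close>: \<open>p * (1 - s)\<close> is \<open>ln n\<close>, and the
  error \<open>p * s\<^sup>2 = (p - u)\<^sup>2 / p\<close> is at most \<open>1 / u\<close>.\<close>

lemma min_value_upper:
  assumes "2 \<le> n"
  shows "min_value n \<le> exp 1 * ln n + exp 1 / ln n"
proof -
  define u where "u = ln (real n)"
  define p where "p = nat \<lceil>u\<rceil>"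
  define s where "s = 1 - u / p"
  have u: "0 < u" "u \<le> real n - 1" using assms ln_le_minus_one[of "real n"] by (auto simp: u_def)
  then have pu: "u \<le> p" "p < u + 1" unfolding p_def by linarith+
  then have "0 < p" "p < n + 1" using u by linarith+
  then have p: "p \<in> {1..n}" by auto
  have s: "0 \<le> s" "p * s = p - u" using pu p by (auto simp: s_def field_simps)
  have "min_value n \<le> p * real n powr (1 / p)"
    using min_value_le[OF p] p by (auto elim!: order_trans intro!: mult_left_mono powr_mono2)
  also have "\<dots> = p * exp (1 - s)" using assms by (simp add: powr_def u_def s_def)
  also have "\<dots> = exp 1 * (p * exp (- s))" by (simp add: exp_diff exp_minus field_simps)
  also have "\<dots> \<le> exp 1 * (p * (1 - s + s\<^sup>2))"
  proof -
    have "exp (- s) \<le> 1 / (1 + s)"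
      using exp_ge_add_one_self[of s] s by (simp add: exp_minus field_simps)
    also have "\<dots> \<le> 1 - s + s\<^sup>2"
    proof -
      have "(1 - s + s\<^sup>2) * (1 + s) = 1 + s ^ 3"
        by (simp add: power2_eq_square power3_eq_cube algebra_simps)
      then show ?thesis using s(1) by (simp add: pos_divide_le_eq)
    qed
    finally show ?thesis by (intro mult_left_mono) auto
  qed
  also have "\<dots> = exp 1 * u + exp 1 * ((p * s)\<^sup>2 / p)"
  proof -
    have "p * (1 - s + s\<^sup>2) = (p - p * s) + (p * s)\<^sup>2 / p"
      using p by (simp add: field_simps power2_eq_square)
    then show ?thesis by (simp add: s(2) distrib_left)
  qed
  also have "\<dots> \<le> exp 1 * u + exp 1 * (1 / u)"
    using pu u s by (intro add_left_mono mult_left_mono frac_le) (auto simp: power_le_one)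
  finally show ?thesis by (simp add: u_def)
qed

lemma min_value_asymp: "(\<lambda>n. min_value n - exp 1 * ln (real n)) \<in> O(\<lambda>n. 1 / ln (real n))"
proof -
  \<comment> \<open>\<open>f\<close> is the gap between \<open>e * ln n\<close> and the lower bound
    of \<open>min_value_gt\<close>; the upper side is \<open>min_value_upper\<close>.\<close>
  define f where "f n = exp 1 * (ln (real n) - ln (real n + 1 - ln (real n + 1)))" for n :: nat
  have "f \<in> O(\<lambda>n. 1 / ln (real n))" unfolding f_def by real_asymp
  moreover have "(\<lambda>n. \<bar>exp 1 / ln (real n)\<bar>) \<in> O(\<lambda>n. 1 / ln (real n))"
    by (intro bigoI[of _ "exp 1"]) simp
  ultimately have "(\<lambda>n. \<bar>f n\<bar> + \<bar>exp 1 / ln (real n)\<bar>) \<in> O(\<lambda>n. 1 / ln (real n))"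
    by (intro sum_in_bigo) auto
  moreover have "\<bar>min_value n - exp 1 * ln n\<bar> \<le> \<bar>f n\<bar> + \<bar>exp 1 / ln (real n)\<bar>" if "2 \<le> n" for n
    using min_value_gt[of n] min_value_upper[of n] that unfolding f_def right_diff_distrib by linarith
  then have "(\<lambda>n. min_value n - exp 1 * ln n) \<in> O(\<lambda>n. \<bar>f n\<bar> + \<bar>exp 1 / ln (real n)\<bar>)"
    by (intro bigoI[of _ 1] eventually_sequentiallyI[of 2]) auto
  ultimately show ?thesis using landau_o.big_trans by blast
qed

theorem theorem4:
  shows "(\<forall>n \<ge> 1. \<forall>G \<in> (graph_class n :: 'a pair_pre_digraph set).
            min_sum_inf G > ereal (exp 1 * ln (real n + 1 - ln (real n + 1)))) \<and>
         (\<exists>\<mu> :: nat \<Rightarrow> real. (\<forall>n \<ge> 1. is_class_min n (\<mu> n)) \<and>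
            (\<lambda>n. \<mu> n - exp 1 * ln (real n)) \<in> O(\<lambda>n. 1 / ln (real n)))"
proof (intro conjI allI impI ballI exI)
  fix n and G :: "'a pair_pre_digraph"
  assume "1 \<le> n" "G \<in> graph_class n"
  then show "min_sum_inf G > ereal (exp 1 * ln (real n + 1 - ln (real n + 1)))"
    using min_value_gt[of n] min_value_le_min_sum_inf[of G n]
    by (metis less_ereal.simps(1) order_less_le_trans)
qed (auto intro: is_class_min_min_value min_value_asymp)

end
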